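(* For every topological space $X$, $$\operatorname{c}(X)\le \mu(X)\le \operatorname{sat}(X).$$
   Context: Spaces are non-empty, and cardinal invariants take infinite values (finite values are replaced by $\omega$); no separation axioms are assumed. Let $\mathcal T$ be the family of all non-empty open subsets of $X$ and, for an ordinal $\alpha$, let $\mathcal T^\alpha$ be the set of all sequences of length $\alpha$ of elements of $\mathcal T$. For an infinite cardinal $\kappa$, the space $X$ is called $\kappa$-favorable if there is a function $s:\bigcup\{\mathcal T^\alpha:\alpha<\kappa\}\to\mathcal T$ such that for every sequence $\{B_{\alpha+1}:\alpha<\kappa\}\subseteq\mathcal T$ with $B_1\subseteq s(\emptyset)$ and $B_{\alpha+1}\subseteq s(\{B_{\gamma+1}:\gamma<\alpha\})$ for each $\alpha<\kappa$, the union $\bigcup\{B_{\alpha+1}:\alpha<\kappa\}$ is dense in $X$. Here $\mu(X)$ is the least infinite cardinal $\kappa$ such that $X$ is $\kappa$-favorable; $\operatorname{c}(X)$ is the cellularity of $X$, i.e. the least infinite cardinal $\kappa$ such that every family of pairwise disjoint non-empty open subsets of $X$ has cardinality $\le\kappa$; and $\operatorname{sat}(X)$ is the least infinite cardinal $\kappa$ such that every family of pairwise disjoint non-empty open subsets of $X$ has cardinality $<\kappa$. *)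

theory Defs
  imports "HOL-Analysis.Analysis"
begin

unbundle cardinal_syntax

text \<open>
  Cardinals are represented as in the library by well-orders \<open>\<kappa>\<close> with \<open>Card_order \<kappa>\<close>, and compared
  by \<open>\<le>o\<close> and \<open><o\<close>. The ordinals below \<open>\<kappa>\<close> are represented by the elements of \<open>Field \<kappa>\<close>:
  \<open>a\<close> stands for the order type of its set \<open>underS \<kappa> a\<close> of strict predecessors.
\<close>

definition nonempty_opens :: "'a topology \<Rightarrow> 'a set set" where
  "nonempty_opens X = {U. openin X U \<and> U \<noteq> {}}"

text \<open>
  A sequence is a partial map defined exactly on the ordinals below its length, so that
  sequences of different lengths are different. A move sequence \<open>B\<close> lists the sets
  \<open>B\<^bsub>\<alpha>+1\<^esub>\<close> under the index \<open>\<alpha>\<close>; accordingly the sequence of all \<open>B\<^bsub>\<gamma>+1\<^esub>\<close> with \<open>\<gamma> < \<alpha>\<close>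
  has length \<open>\<alpha>\<close>.
\<close>

definition open_seqs :: "'a topology \<Rightarrow> 'k rel \<Rightarrow> 'k \<Rightarrow> ('k \<rightharpoonup> 'a set) set" where
  "open_seqs X \<kappa> \<alpha> = {\<sigma>. dom \<sigma> = underS \<kappa> \<alpha> \<and> ran \<sigma> \<subseteq> nonempty_opens X}"

definition initial_seq :: "'k rel \<Rightarrow> ('k \<Rightarrow> 'a set) \<Rightarrow> 'k \<Rightarrow> ('k \<rightharpoonup> 'a set)" where
  "initial_seq \<kappa> B \<alpha> = (\<lambda>\<gamma>. Some (B \<gamma>)) |` underS \<kappa> \<alpha>"

text \<open>
  The condition \<open>B\<^bsub>1\<^esub> \<subseteq> s \<emptyset>\<close> is the case where \<open>\<alpha>\<close> is the least element of \<open>Field \<kappa>\<close>.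
\<close>

definition favorable :: "'k rel \<Rightarrow> 'a topology \<Rightarrow> bool" where
  "favorable \<kappa> X \<longleftrightarrow>
     (\<exists>s \<in> (\<Union>\<alpha>\<in>Field \<kappa>. open_seqs X \<kappa> \<alpha>) \<rightarrow> nonempty_opens X.
        \<forall>B \<in> Field \<kappa> \<rightarrow> nonempty_opens X.
          (\<forall>\<alpha>\<in>Field \<kappa>. B \<alpha> \<subseteq> s (initial_seq \<kappa> B \<alpha>)) \<longrightarrow>
          X closure_of (\<Union>\<alpha>\<in>Field \<kappa>. B \<alpha>) = topspace X)"

definition disjoint_open_family :: "'a topology \<Rightarrow> 'a set set \<Rightarrow> bool" where
  "disjoint_open_family X \<F> \<longleftrightarrow> \<F> \<subseteq> nonempty_opens X \<and> disjoint \<F>"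

text \<open>
  The least infinite cardinal with property \<open>P\<close>, unique up to order isomorphism. For an
  isomorphism-invariant \<open>P\<close>, leastness among the cardinals on the type \<open>'k\<close> is leastness
  among all cardinals, since every cardinal below one on \<open>'k\<close> is isomorphic to one on \<open>'k\<close>.
\<close>

definition least_infinite_card :: "('k rel \<Rightarrow> bool) \<Rightarrow> 'k rel" where
  "least_infinite_card P =
     (SOME \<kappa>. Card_order \<kappa> \<and> infinite (Field \<kappa>) \<and> P \<kappa> \<and>
        (\<forall>\<kappa>'. Card_order \<kappa>' \<and> infinite (Field \<kappa>') \<and> P \<kappa>' \<longrightarrow> \<kappa> \<le>o \<kappa>'))"

text \<open>
  A pairwise disjoint family of non-empty subsets of \<open>X\<close> has at most as many members as \<open>X\<close>
  has points, so a type of cardinality \<open>2\<^bsup>|X|+\<omega>\<^esup>\<close> carries all the cardinals needed below.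
\<close>

type_synonym 'a inv_card = "('a + nat) set rel"

definition cellularity :: "'a topology \<Rightarrow> 'a inv_card" where
  "cellularity X = least_infinite_card (\<lambda>\<kappa>. \<forall>\<F>. disjoint_open_family X \<F> \<longrightarrow> |\<F>| \<le>o \<kappa>)"

definition saturation :: "'a topology \<Rightarrow> 'a inv_card" where
  "saturation X = least_infinite_card (\<lambda>\<kappa>. \<forall>\<F>. disjoint_open_family X \<F> \<longrightarrow> |\<F>| <o \<kappa>)"

definition favorability :: "'a topology \<Rightarrow> 'a inv_card" where
  "favorability X = least_infinite_card (\<lambda>\<kappa>. favorable \<kappa> X)"

end

theory Submission
  imports Defs
begin

text \<open>
  For the first inequality, play against a winning strategy, shrinking each move so that it meets
  at most one member of a given disjoint family: the union of the moves is dense, so it meets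
  every member, and a member is determined by the index of a move that meets it. For the second,
  the strategy is to play the complement of the closure of the moves made so far; a play whose
  union is not dense then consists of pairwise disjoint sets, too many for \<open>sat(X)\<close>.
\<close>

text \<open>Any non-empty set of cardinals on one type has a least member up to
  \<open>\<le>o\<close>, so a single witness \<open>\<kappa>\<^sub>0\<close> makes the description
  behind \<open>SOME\<close> satisfiable.\<close>

lemma least_infinite_card:
  fixes \<kappa>\<^sub>0 :: "'k rel"
  assumes "Card_order \<kappa>\<^sub>0" "infinite (Field \<kappa>\<^sub>0)" "P \<kappa>\<^sub>0"
  shows "Card_order (least_infinite_card P) \<and> infinite (Field (least_infinite_card P)) \<and>
    P (least_infinite_card P) \<and>
    (\<forall>\<kappa>'. Card_order \<kappa>' \<and> infinite (Field \<kappa>') \<and> P \<kappa>' \<longrightarrow> least_infinite_card P \<le>o \<kappa>')"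
proof -
  let ?R = "{\<kappa> :: 'k rel. Card_order \<kappa> \<and> infinite (Field \<kappa>) \<and> P \<kappa>}"
  have "\<exists>\<kappa>\<in>?R. \<forall>\<kappa>'\<in>?R. \<kappa> \<le>o \<kappa>'"
    by (rule exists_minim_Card_order) (use assms in auto)
  then have "\<exists>\<kappa>. Card_order \<kappa> \<and> infinite (Field \<kappa>) \<and> P \<kappa> \<and>
      (\<forall>\<kappa>'. Card_order \<kappa>' \<and> infinite (Field \<kappa>') \<and> P \<kappa>' \<longrightarrow> \<kappa> \<le>o \<kappa>')"
    by blast
  then show ?thesis
    unfolding least_infinite_card_def by (rule someI_ex)
qed

text \<open>A point chosen from each member determines that member, by disjointness. This bounds all
  disjoint open families by the size of the space.\<close>

lemma card_disjoint_family_le: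
  assumes "disjoint \<F>" "{} \<notin> \<F>"
  shows "|\<F>| \<le>o |\<Union>\<F>|"
proof -
  have p: "(SOME x. x \<in> V) \<in> V" if "V \<in> \<F>" for V
    using that assms(2) by (auto simp: some_in_eq)
  have "inj_on (\<lambda>V. SOME x. x \<in> V) \<F>"
  proof (rule inj_onI, rule ccontr)
    fix V W assume VW: "V \<in> \<F>" "W \<in> \<F>" "(SOME x. x \<in> V) = (SOME x. x \<in> W)" "V \<noteq> W"
    then have "V \<inter> W = {}"
      using assms(1) by (simp add: disjointD)
    moreover have "(SOME x. x \<in> V) \<in> V \<inter> W"
      using p[OF VW(1)] p[OF VW(2)] VW(3) by simp
    ultimately show False by simp
  qed
  moreover have "(\<lambda>V. SOME x. x \<in> V) ` \<F> \<subseteq> \<Union>\<F>"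
    using p by blast
  ultimately show ?thesis
    using card_of_ordLeq by blast
qed

lemma initial_seq_in_open_seqs:
  assumes "\<And>\<gamma>. \<gamma> \<in> underS \<kappa> \<alpha> \<Longrightarrow> B \<gamma> \<in> nonempty_opens X"
  shows "initial_seq \<kappa> B \<alpha> \<in> open_seqs X \<kappa> \<alpha>"
  using assms by (auto simp: initial_seq_def open_seqs_def ran_def restrict_map_def dom_def)

lemma ran_initial_seq: "ran (initial_seq \<kappa> B \<alpha>) = B ` underS \<kappa> \<alpha>"
  by (auto simp: initial_seq_def ran_def restrict_map_def)

text \<open>If \<open>U\<close> meets some \<open>V\<close> in the family, then
  \<open>U \<inter> V\<close> meets no other member; otherwise \<open>U\<close> itself meets
  none.\<close>

lemma shrink_to_meet_at_most_one:
  assumes "U \<in> nonempty_opens X" "disjoint_open_family X \<F>"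
  shows "\<exists>W \<in> nonempty_opens X. W \<subseteq> U \<and>
    (\<forall>V\<in>\<F>. \<forall>V'\<in>\<F>. W \<inter> V \<noteq> {} \<longrightarrow> W \<inter> V' \<noteq> {} \<longrightarrow> V = V')"
proof (cases "\<exists>V\<in>\<F>. U \<inter> V \<noteq> {}")
  case True
  then obtain V where V: "V \<in> \<F>" "U \<inter> V \<noteq> {}" by blast
  have "U \<inter> V \<in> nonempty_opens X"
    using assms V by (auto simp: nonempty_opens_def disjoint_open_family_def)
  moreover have "V' = V" if "V' \<in> \<F>" "U \<inter> V \<inter> V' \<noteq> {}" for V'
    using assms(2) V that by (auto simp: disjoint_open_family_def pairwise_def disjnt_def)
  ultimately show ?thesis by (intro bexI[of _ "U \<inter> V"]) auto
qed (use assms in auto)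

lemma favorable_imp_disjoint_family_le:
  fixes X :: "'a topology" and \<kappa> :: "'k rel"
  assumes \<kappa>: "Card_order \<kappa>" and fav: "favorable \<kappa> X" and \<F>: "disjoint_open_family X \<F>"
  shows "|\<F>| \<le>o \<kappa>"
proof -
  obtain s where s: "s \<in> (\<Union>\<alpha>\<in>Field \<kappa>. open_seqs X \<kappa> \<alpha>) \<rightarrow> nonempty_opens X"
    and win: "\<forall>B \<in> Field \<kappa> \<rightarrow> nonempty_opens X.
      (\<forall>\<alpha>\<in>Field \<kappa>. B \<alpha> \<subseteq> s (initial_seq \<kappa> B \<alpha>)) \<longrightarrow>
      X closure_of (\<Union>\<alpha>\<in>Field \<kappa>. B \<alpha>) = topspace X"
    using fav unfolding favorable_def by (rule bexE)
  have "Well_order \<kappa>"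
    using \<kappa> by (simp add: card_order_on_well_order_on)
  then have wf: "wf (\<kappa> - Id)"
    by (simp add: well_order_on_def)
  \<comment> \<open>The recursion below has to supply a value at every element of the type, so the
    requirement is made vacuous outside \<open>Field \<kappa>\<close>.\<close>
  define P where "P B \<alpha> W \<longleftrightarrow> (\<alpha> \<in> Field \<kappa> \<longrightarrow> W \<in> nonempty_opens X \<and>
      W \<subseteq> s (initial_seq \<kappa> B \<alpha>) \<and>
      (\<forall>V\<in>\<F>. \<forall>V'\<in>\<F>. W \<inter> V \<noteq> {} \<longrightarrow> W \<inter> V' \<noteq> {} \<longrightarrow> V = V'))" for B \<alpha> W
  \<comment> \<open>Well-founded recursion with choice applies because \<open>P B \<alpha>\<close>
    depends on \<open>B\<close> only through the moves before \<alpha>.\<close>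
  have "\<exists>B. \<forall>\<alpha>. P B \<alpha> (B \<alpha>)"
  proof (rule dependent_wf_choice[OF wf])
    fix f g :: "'k \<Rightarrow> 'a set" and \<alpha> W
    assume "\<And>\<gamma>. (\<gamma>, \<alpha>) \<in> \<kappa> - Id \<Longrightarrow> f \<gamma> = g \<gamma>"
    then have "initial_seq \<kappa> f \<alpha> = initial_seq \<kappa> g \<alpha>"
      by (auto simp: initial_seq_def restrict_map_def underS_def)
    then show "P f \<alpha> W = P g \<alpha> W"
      by (simp add: P_def)
  next
    fix \<alpha> and f :: "'k \<Rightarrow> 'a set"
    assume IH: "\<And>\<gamma>. (\<gamma>, \<alpha>) \<in> \<kappa> - Id \<Longrightarrow> P f \<gamma> (f \<gamma>)"
    show "\<exists>W. P f \<alpha> W"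
    proof (cases "\<alpha> \<in> Field \<kappa>")
      case True
      have "initial_seq \<kappa> f \<alpha> \<in> open_seqs X \<kappa> \<alpha>"
        \<comment> \<open>Earlier moves are non-empty and open by \<open>IH\<close>, so the position
          lies in the domain on which \<open>s\<close> is controlled.\<close>
        using IH by (intro initial_seq_in_open_seqs) (auto simp: underS_def P_def intro: FieldI1)
      then have "s (initial_seq \<kappa> f \<alpha>) \<in> nonempty_opens X"
        using s True by blast
      from shrink_to_meet_at_most_one[OF this \<F>] show ?thesis
        by (elim bexE) (auto simp: P_def)
    qed (simp add: P_def)
  qed
  then obtain B where B: "\<And>\<alpha>. P B \<alpha> (B \<alpha>)" by blast
  have dense: "X closure_of (\<Union>\<alpha>\<in>Field \<kappa>. B \<alpha>) = topspace X"
    using B by (intro win[rule_format]) (auto simp: P_def)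
  have "\<exists>\<alpha>\<in>Field \<kappa>. B \<alpha> \<inter> V \<noteq> {}" if "V \<in> \<F>" for V
  proof -
    have "openin X V" "V \<noteq> {}"
      using \<F> that by (auto simp: disjoint_open_family_def nonempty_opens_def)
    then have "V \<inter> X closure_of (\<Union>\<alpha>\<in>Field \<kappa>. B \<alpha>) \<noteq> {}"
      unfolding dense using openin_subset by blast
    then show ?thesis
      using openin_Int_closure_of_eq_empty[OF \<open>openin X V\<close>] by blast
  qed
  then obtain h where h: "\<And>V. V \<in> \<F> \<Longrightarrow> h V \<in> Field \<kappa> \<and> B (h V) \<inter> V \<noteq> {}"
    by metis
  \<comment> \<open>If \<open>h V = h V'\<close>, the single move \<open>B (h V)\<close> meets both
    \<open>V\<close> and \<open>V'\<close>, which forces \<open>V = V'\<close>.\<close>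
  have "inj_on h \<F>"
    using h B unfolding P_def inj_on_def by metis
  then have "|\<F>| \<le>o |Field \<kappa>|"
    using h card_of_ordLeq by blast
  then show ?thesis
    using card_of_Field_ordIso[OF \<kappa>] ordLeq_ordIso_trans by blast
qed

lemma favorable_if_disjoint_families_less:
  fixes X :: "'a topology" and \<kappa> :: "'k rel"
  assumes \<kappa>: "Card_order \<kappa>" and ne: "topspace X \<noteq> {}"
    and sat: "\<And>\<F>. disjoint_open_family X \<F> \<Longrightarrow> |\<F>| <o \<kappa>"
  shows "favorable \<kappa> X"
proof -
  define C where "C \<sigma> = topspace X - X closure_of \<Union>(ran \<sigma>)" for \<sigma> :: "'k \<rightharpoonup> 'a set"
  \<comment> \<open>Once the earlier moves have dense union, \<open>C \<sigma>\<close> is empty and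
    not a legal reply; the whole space serves as default and is legal by \<open>ne\<close>.\<close>
  define s where "s \<sigma> = (if C \<sigma> = {} then topspace X else C \<sigma>)" for \<sigma>
  have "s \<sigma> \<in> nonempty_opens X" for \<sigma>
    using ne by (auto simp: s_def C_def nonempty_opens_def openin_diff)
  moreover have "X closure_of (\<Union>\<alpha>\<in>Field \<kappa>. B \<alpha>) = topspace X"
    if B: "B \<in> Field \<kappa> \<rightarrow> nonempty_opens X"
      and play: "\<forall>\<alpha>\<in>Field \<kappa>. B \<alpha> \<subseteq> s (initial_seq \<kappa> B \<alpha>)" for B
  proof (rule ccontr)
    assume not_dense: "X closure_of (\<Union>\<alpha>\<in>Field \<kappa>. B \<alpha>) \<noteq> topspace X"
    have disj: "B \<alpha> \<inter> B \<gamma> = {}" if \<alpha>: "\<alpha> \<in> Field \<kappa>" and \<gamma>: "\<gamma> \<in> underS \<kappa> \<alpha>" for \<alpha> \<gamma>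
    proof -
      let ?U = "\<Union>(B ` underS \<kappa> \<alpha>)"
      have "X closure_of ?U \<subseteq> X closure_of (\<Union>\<alpha>\<in>Field \<kappa>. B \<alpha>)"
        by (intro closure_of_mono UN_mono) (auto simp: underS_def intro: FieldI1)
      \<comment> \<open>Since the whole union is not dense, neither is the union of any initial
        part: the default reply never occurs in this play.\<close>
      then have "C (initial_seq \<kappa> B \<alpha>) \<noteq> {}"
        using not_dense closure_of_subset_topspace[of X]
        unfolding C_def ran_initial_seq by blast
      then have "B \<alpha> \<subseteq> C (initial_seq \<kappa> B \<alpha>)"
        using bspec[OF play \<alpha>] by (simp add: s_def)
      then have "B \<alpha> \<inter> X closure_of ?U = {}"
        unfolding C_def ran_initial_seq by blast
      moreover have "B \<gamma> \<subseteq> topspace X"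
        using B \<gamma> by (auto simp: nonempty_opens_def underS_def Pi_iff FieldI1 dest!: openin_subset)
      then have "B \<gamma> \<subseteq> X closure_of (B \<gamma>)"
        by (rule closure_of_subset)
      moreover have "X closure_of (B \<gamma>) \<subseteq> X closure_of ?U"
        using \<gamma> by (intro closure_of_mono) auto
      ultimately show ?thesis by blast
    qed
    have total: "\<gamma> \<in> underS \<kappa> \<alpha> \<or> \<alpha> \<in> underS \<kappa> \<gamma>"
      if "\<alpha> \<in> Field \<kappa>" "\<gamma> \<in> Field \<kappa>" "\<alpha> \<noteq> \<gamma>" for \<alpha> \<gamma>
      using \<kappa> that
      by (auto simp: card_order_on_def well_order_on_def linear_order_on_def total_on_def underS_def)
    have disj': "B \<alpha> \<inter> B \<gamma> = {}" if "\<alpha> \<in> Field \<kappa>" "\<gamma> \<in> Field \<kappa>" "\<alpha> \<noteq> \<gamma>" for \<alpha> \<gamma>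
      using total[OF that] disj that by blast
    have B': "B \<alpha> \<in> nonempty_opens X" "B \<alpha> \<noteq> {}" if "\<alpha> \<in> Field \<kappa>" for \<alpha>
      using B that by (auto simp: nonempty_opens_def)
    \<comment> \<open>Two equal moves at different indices would be disjoint from themselves, hence
      empty.\<close>
    have "inj_on B (Field \<kappa>)"
      using disj' B'(2) by (intro inj_onI) (metis Int_absorb)
    then have "|Field \<kappa>| \<le>o |B ` Field \<kappa>|"
      using card_of_ordLeq by blast
    moreover have "disjoint_open_family X (B ` Field \<kappa>)"
      using B' disj' unfolding disjoint_open_family_def pairwise_def disjnt_def by blast
    then have "|B ` Field \<kappa>| <o \<kappa>"
      by (rule sat)
    ultimately have "|Field \<kappa>| <o \<kappa>"
      by (rule ordLeq_ordLess_trans)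
    then show False
      using card_of_Field_ordIso[OF \<kappa>] not_ordLess_ordIso by blast
  qed
  ultimately show ?thesis
    unfolding favorable_def by (intro bexI[of _ s]) auto
qed

theorem proposition2:
  fixes X :: "'a topology"
  assumes "topspace X \<noteq> {}"
  shows "cellularity X \<le>o favorability X \<and> favorability X \<le>o saturation X"
proof -
  \<comment> \<open>This cardinal is the witness that \<open>saturation X\<close> and
    \<open>cellularity X\<close> are well defined. The summand \<open>nat\<close> makes it infinite;
    the power set gives, by Cantor, the strict bound that saturation needs.\<close>
  let ?\<Omega> = "|UNIV :: ('a + nat) set set|"
  have inf: "infinite (Field ?\<Omega>)"
    by (simp add: Field_card_of Finite_Set.finite_set)
  have lt: "|\<F>| <o ?\<Omega>" if "disjoint_open_family X \<F>" for \<F>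
  proof -
    have "|\<F>| \<le>o |\<Union>\<F>|"
      using that
      by (intro card_disjoint_family_le) (auto simp: disjoint_open_family_def nonempty_opens_def)
    also have "|\<Union>\<F>| \<le>o |UNIV :: ('a + nat) set|"
      by (rule card_of_ordLeqI[of Inl]) auto
    also have "|UNIV :: ('a + nat) set| <o ?\<Omega>"
      by (metis Pow_UNIV card_of_Pow)
    finally show ?thesis .
  qed
  note sat = least_infinite_card[of ?\<Omega> "\<lambda>\<kappa>. \<forall>\<F>. disjoint_open_family X \<F> \<longrightarrow> |\<F>| <o \<kappa>",
      OF card_of_Card_order inf, folded saturation_def]
  note cell = least_infinite_card[of ?\<Omega> "\<lambda>\<kappa>. \<forall>\<F>. disjoint_open_family X \<F> \<longrightarrow> |\<F>| \<le>o \<kappa>",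
      OF card_of_Card_order inf, folded cellularity_def]
  \<comment> \<open>This gives the second inequality by leastness, and also supplies the witness
    without which \<open>favorability X\<close> would be an arbitrary choice.\<close>
  have sat_fav: "favorable (saturation X) X"
    using sat lt assms by (intro favorable_if_disjoint_families_less) auto
  note fav = least_infinite_card[of "saturation X" "\<lambda>\<kappa>. favorable \<kappa> X", folded favorability_def]
  have "favorability X \<le>o saturation X"
    using fav sat sat_fav lt by blast
  \<comment> \<open>So \<open>favorability X\<close> is among the infinite cardinals of which
    \<open>cellularity X\<close> is the least.\<close>
  moreover have "\<forall>\<F>. disjoint_open_family X \<F> \<longrightarrow> |\<F>| \<le>o favorability X"
    using fav sat sat_fav lt favorable_imp_disjoint_family_le by blast
  then have "cellularity X \<le>o favorability X"
    using cell fav sat sat_fav lt ordLess_imp_ordLeq by blast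
  ultimately show ?thesis by blast
qed

end
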